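(* A triangulation of a (rectangular) grid graph is word-representable if and only if it is $3$-colorable.
   Context: A grid graph is the graph of an $m\times n$ rectangle of unit squares: vertices are the corners of the squares and edges are the sides of the squares. A triangulation of it is obtained by adding, in each unit square, exactly one of its two diagonals as an edge. A graph $G=(V,E)$ is word-representable if there is a word $w$ over the alphabet $V$ such that for all distinct $x,y\in V$, the letters $x$ and $y$ alternate in $w$ if and only if $\{x,y\}\in E$. A graph is $3$-colorable if its vertices can be colored with at most $3$ colors so that adjacent vertices receive different colors. *)

theory Defs
  imports Main
begin

text \<open>A simple graph is given by a vertex set and a set of two-element edge sets.\<close>

fun alt_word :: "'a \<Rightarrow> 'a \<Rightarrow> nat \<Rightarrow> 'a list" where
  "alt_word x y 0 = []"
| "alt_word x y (Suc k) = x # alt_word y x k"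

text \<open>Deleting all letters other than \<open>x\<close> and \<open>y\<close> leaves \<open>xyxy...\<close> or \<open>yxyx...\<close>,
  of even or odd length.\<close>

definition letters_alternate :: "'a \<Rightarrow> 'a \<Rightarrow> 'a list \<Rightarrow> bool" where
  "letters_alternate x y w \<longleftrightarrow>
     (\<exists>k. filter (\<lambda>z. z = x \<or> z = y) w = alt_word x y k \<or>
          filter (\<lambda>z. z = x \<or> z = y) w = alt_word y x k)"

definition word_representable :: "'a set \<Rightarrow> 'a set set \<Rightarrow> bool" where
  "word_representable V E \<longleftrightarrow>
     (\<exists>w. set w \<subseteq> V \<and>
          (\<forall>x\<in>V. \<forall>y\<in>V. x \<noteq> y \<longrightarrow> (letters_alternate x y w \<longleftrightarrow> {x, y} \<in> E)))"

definition colorable :: "nat \<Rightarrow> 'a set \<Rightarrow> 'a set set \<Rightarrow> bool" where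
  "colorable k V E \<longleftrightarrow>
     (\<exists>c :: 'a \<Rightarrow> nat. c ` V \<subseteq> {..<k} \<and>
          (\<forall>x\<in>V. \<forall>y\<in>V. {x, y} \<in> E \<longrightarrow> c x \<noteq> c y))"

text \<open>The unit square \<open>(i, j)\<close>, for \<open>i < m\<close> and \<open>j < n\<close>, has the corners
  \<open>(i, j)\<close>, \<open>(i + 1, j)\<close>, \<open>(i, j + 1)\<close>, \<open>(i + 1, j + 1)\<close>.\<close>

definition grid_vertices :: "nat \<Rightarrow> nat \<Rightarrow> (nat \<times> nat) set" where
  "grid_vertices m n = {0..m} \<times> {0..n}"

definition grid_edges :: "nat \<Rightarrow> nat \<Rightarrow> (nat \<times> nat) set set" where
  "grid_edges m n =
     {{(i, j), (i + 1, j)} | i j. i < m \<and> j \<le> n} \<union>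
     {{(i, j), (i, j + 1)} | i j. i \<le> m \<and> j < n}"

definition square_diagonals :: "nat \<Rightarrow> nat \<Rightarrow> (nat \<times> nat) set set" where
  "square_diagonals i j = {{(i, j), (i + 1, j + 1)}, {(i + 1, j), (i, j + 1)}}"

definition grid_triangulation :: "nat \<Rightarrow> nat \<Rightarrow> (nat \<times> nat) set set \<Rightarrow> bool" where
  "grid_triangulation m n E \<longleftrightarrow>
     (\<exists>d. (\<forall>i<m. \<forall>j<n. d i j \<in> square_diagonals i j) \<and>
          E = grid_edges m n \<union> {d i j | i j. i < m \<and> j < n})"

end

theory Submission
  imports Defs
begin

text \<open>Call the unit squares with the diagonal \<open>(i, j), (i + 1, j + 1)\<close> \<^emph>\<open>main\<close>.
  The neighbours of an interior vertex of odd degree induce a cycle of length 5 or 7.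
  In a word-representable graph the neighbourhood of a vertex is a comparability graph, which an
  induced odd cycle of length at least 5 is not; so all interior degrees are even.
  Then the pattern of main squares has the form \<open>\<alpha> i = \<beta> j\<close>, and
  \<open>X i + Y j\<close> modulo 3 is a proper colouring if \<open>X\<close> and \<open>Y\<close> change by \<open>1\<close> or \<open>-1\<close> according to
  \<open>\<alpha>\<close> and \<open>\<beta>\<close>.

  Conversely, orient the edges of a 3-coloured graph from smaller to larger colours. A word is built
  by concatenating blocks, in each of which every edge \<open>x \<rightarrow> y\<close> reads \<open>xyxy...xy\<close>. For each
  non-adjacent pair there is such a block in which it fails to alternate: topological orders
  suffice unless the colours are \<open>0\<close> and \<open>2\<close>, and then the two letters are exchanged
  where two topological orders meet.\<close>

section \<open>Alternation\<close>

lemma distinct_adj_alt_word: "x \<noteq> y \<Longrightarrow> distinct_adj (alt_word x y k)"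
proof (induction k arbitrary: x y)
  case (Suc k)
  then show ?case by (cases k) auto
qed simp

lemma distinct_adj_imp_alt_word:
  assumes "distinct_adj l" "set l \<subseteq> {x, y}" "l = [] \<or> hd l = x"
  shows "l = alt_word x y (length l)"
  using assms
proof (induction l arbitrary: x y)
  case (Cons a l)
  have "l = alt_word y x (length l)"
  proof (rule Cons.IH)
    show "l = [] \<or> hd l = y"
      using Cons.prems by (cases l) auto
  qed (use Cons.prems in \<open>auto simp: distinct_adj_Cons\<close>)
  then show ?case using Cons.prems by simp
qed simp

text \<open>A word over two letters without equal neighbours is fixed by its first letter and its
  length. In this form alternation is easy to test on concatenations.\<close>

lemma letters_alternate_iff_distinct_adj:
  assumes "x \<noteq> y"
  shows "letters_alternate x y w \<longleftrightarrow> distinct_adj (filter (\<lambda>z. z = x \<or> z = y) w)"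
    (is "_ \<longleftrightarrow> distinct_adj ?l")
proof
  assume "letters_alternate x y w"
  then show "distinct_adj ?l"
    using assms distinct_adj_alt_word[of x y] distinct_adj_alt_word[of y x]
    by (auto simp: letters_alternate_def)
next
  assume d: "distinct_adj ?l"
  have s: "set ?l \<subseteq> {x, y}" by auto
  then have "?l = [] \<or> hd ?l = x \<or> hd ?l = y"
    using hd_in_set[of ?l] by blast
  then show "letters_alternate x y w"
    using distinct_adj_imp_alt_word[OF d s] distinct_adj_imp_alt_word[OF d, of y x] s
    unfolding letters_alternate_def by (metis insert_commute)
qed

section \<open>Alternation through prefix counts\<close>

text \<open>Integers, because the shift by one in \<open>shifted_count\<close> can give -1.\<close>

definition prefix_count :: "'a list \<Rightarrow> nat \<Rightarrow> 'a \<Rightarrow> int" where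
  "prefix_count w i x = int (count_list (take i w) x)"

definition leads :: "'a list \<Rightarrow> 'a \<Rightarrow> 'a \<Rightarrow> bool" where
  "leads w x y \<longleftrightarrow>
     (\<forall>i. prefix_count w i y \<le> prefix_count w i x \<and> prefix_count w i x \<le> prefix_count w i y + 1)"

lemma prefix_count_0 [simp]: "prefix_count w 0 x = 0"
  by (simp add: prefix_count_def)

lemma prefix_count_Cons_Suc [simp]:
  "prefix_count (z # w) (Suc i) x = prefix_count w i x + (if z = x then 1 else 0)"
  by (simp add: prefix_count_def)

lemma all_nat_split: "(\<forall>i. P i) \<longleftrightarrow> P 0 \<and> (\<forall>i. P (Suc i))"
  by (metis not0_implies_Suc)

text \<open>Reading \<open>x\<close> adds one to its count, which exchanges the roles of
  \<open>x\<close> and \<open>y\<close> for the rest of the word.\<close>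

lemma leads_Cons:
  assumes "x \<noteq> y"
  shows "leads (z # w) x y \<longleftrightarrow> (if z = x then leads w y x else z \<noteq> y \<and> leads w x y)"
proof -
  have Suc: "leads (z # w) x y \<longleftrightarrow> (\<forall>i. prefix_count (z # w) (Suc i) y \<le> prefix_count (z # w) (Suc i) x \<and>
      prefix_count (z # w) (Suc i) x \<le> prefix_count (z # w) (Suc i) y + 1)"
    unfolding leads_def by (subst all_nat_split) simp
  consider "z = x" | "z = y" | "z \<noteq> x" "z \<noteq> y" by blast
  then show ?thesis
  proof cases
    case 1
    then show ?thesis using assms unfolding Suc by (auto simp: leads_def)
  next
    case 2
    then have "\<not> leads (z # w) x y"
      \<comment> \<open>The prefix of length one already contains more \<open>y\<close> than
        \<open>x\<close>.\<close>
      using assms unfolding Suc by (auto intro!: exI[of _ 0])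
    then show ?thesis using 2 assms by simp
  next
    case 3
    then show ?thesis using assms unfolding Suc by (simp add: leads_def)
  qed
qed

lemma leadsD:
  assumes "leads w x y"
  shows "prefix_count w i y \<le> prefix_count w i x" "prefix_count w i x \<le> prefix_count w i y + 1"
  using assms by (simp_all add: leads_def)

lemma leads_iff_alt_word:
  assumes "x \<noteq> y"
  shows "leads w x y \<longleftrightarrow> (\<exists>k. filter (\<lambda>z. z = x \<or> z = y) w = alt_word x y k)"
  using assms
proof (induction w arbitrary: x y)
  case Nil
  show ?case by (auto simp: leads_def prefix_count_def intro: exI[of _ 0])
next
  case (Cons z w)
  have Cons_eq: "(\<exists>k. a # l = alt_word x y k) \<longleftrightarrow> a = x \<and> (\<exists>k. l = alt_word y x k)" for a l
  proof -
    have "(\<exists>k. a # l = alt_word x y k) \<longleftrightarrow> (\<exists>k. a # l = alt_word x y (Suc k))"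
      by (metis alt_word.simps(1) list.distinct(1) not0_implies_Suc)
    then show ?thesis by auto
  qed
  have "(\<lambda>z. z = y \<or> z = x) = (\<lambda>z. z = x \<or> z = y)" by auto
  then show ?case
    using Cons.IH[of x y] Cons.IH[of y x] Cons.prems
    by (auto simp: leads_Cons Cons_eq)
qed

lemma letters_alternate_iff_leads:
  assumes "x \<noteq> y"
  shows "letters_alternate x y w \<longleftrightarrow> leads w x y \<or> leads w y x"
proof -
  have "(\<lambda>z. z = y \<or> z = x) = (\<lambda>z. z = x \<or> z = y)" by auto
  then show ?thesis
    using assms leads_iff_alt_word[of x y w] leads_iff_alt_word[of y x w]
    by (auto simp: letters_alternate_def)
qed

section \<open>Odd wheels\<close>

text \<open>Letters that lead \<open>v\<close> are counted from their second occurrence on, so that the counts of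
  all letters alternating with \<open>v\<close> lie between that of \<open>v\<close> and one less.\<close>

definition shifted_count :: "'a list \<Rightarrow> 'a \<Rightarrow> nat \<Rightarrow> 'a \<Rightarrow> int" where
  "shifted_count w v i x = prefix_count w i x - (if leads w x v then 1 else 0)"

text \<open>The pointwise order on shifted counts. Its transitivity is what makes the neighbourhood
  of \<open>v\<close> a comparability graph.\<close>

definition dominates :: "'a list \<Rightarrow> 'a \<Rightarrow> 'a \<Rightarrow> 'a \<Rightarrow> bool" where
  "dominates w v x y \<longleftrightarrow> (\<forall>i. shifted_count w v i y \<le> shifted_count w v i x)"

lemma dominates_trans: "dominates w v x y \<Longrightarrow> dominates w v y z \<Longrightarrow> dominates w v x z"
  unfolding dominates_def by (meson order_trans)

lemma shifted_count_bounds: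
  assumes "x \<noteq> v" "letters_alternate v x w"
  shows "prefix_count w i v - 1 \<le> shifted_count w v i x \<and> shifted_count w v i x \<le> prefix_count w i v"
  using assms leadsD[of w x v i] leadsD[of w v x i] unfolding shifted_count_def
  by (auto simp: letters_alternate_iff_leads)

text \<open>The count of \<open>x\<close> exceeds that of \<open>y\<close> by 0 or 1. Shifting
  \<open>x\<close> alone makes this -1 or 0; in every other case the difference stays
  nonnegative.\<close>

lemma leads_imp_dominates:
  assumes "leads w x y"
  shows "dominates w v x y \<or> dominates w v y x"
proof (cases "leads w x v \<and> \<not> leads w y v")
  case True
  then have "dominates w v y x"
    using leadsD(2)[OF assms] by (simp add: dominates_def shifted_count_def algebra_simps)
  then show ?thesis ..
next
  case False
  then have "shifted_count w v i y \<le> shifted_count w v i x" for i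
    using leadsD(1)[OF assms, of i] by (auto simp: shifted_count_def)
  then show ?thesis by (simp add: dominates_def)
qed

text \<open>Both shifted counts lie in the same window of length one below the count of
  \<open>v\<close>, so they differ by at most 1.\<close>

lemma dominates_imp_letters_alternate:
  assumes "x \<noteq> v" "y \<noteq> v" "x \<noteq> y" "letters_alternate v x w" "letters_alternate v y w"
    and "dominates w v x y"
  shows "letters_alternate x y w"
proof -
  have b: "0 \<le> shifted_count w v i x - shifted_count w v i y"
    "shifted_count w v i x - shifted_count w v i y \<le> 1" for i
    using shifted_count_bounds[OF assms(1,4), of i] shifted_count_bounds[OF assms(2,5), of i] assms(6)
    unfolding dominates_def by (auto simp: algebra_simps)
  \<comment> \<open>In the remaining case only \<open>x\<close> is shifted, and at the empty prefix
    the shifted counts -1 and 0 contradict dominance.\<close>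
  consider "leads w x v = leads w y v" | "\<not> leads w x v" "leads w y v"
    using b(1)[of 0] by (auto simp: shifted_count_def split: if_splits)
  then have "leads w x y \<or> leads w y x"
  proof cases
    case 1
    then have "leads w x y"
      using b by (subst leads_def) (simp add: shifted_count_def algebra_simps)
    then show ?thesis ..
  next
    case 2
    then have "leads w y x"
      using b by (subst leads_def) (simp add: shifted_count_def algebra_simps)
    then show ?thesis ..
  qed
  then show ?thesis using assms(3) by (simp add: letters_alternate_iff_leads)
qed

lemma letters_alternate_iff_dominates:
  assumes "x \<noteq> v" "y \<noteq> v" "x \<noteq> y" "letters_alternate v x w" "letters_alternate v y w"
  shows "letters_alternate x y w \<longleftrightarrow> dominates w v x y \<or> dominates w v y x"
proof -
  have "letters_alternate x y w \<longleftrightarrow> letters_alternate y x w"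
    using assms(3) by (auto simp: letters_alternate_iff_leads)
  then show ?thesis
    using assms leads_imp_dominates[of w x y v] leads_imp_dominates[of w y x v]
      dominates_imp_letters_alternate[of x v y w] dominates_imp_letters_alternate[of y v x w]
    by (auto simp: letters_alternate_iff_leads)
qed

text \<open>Orient the rim edges by dominance. Two successive edges in the same direction would make
  a chord comparable by transitivity, so the directions alternate, which an odd period
  forbids.\<close>

lemma odd_wheel_not_alternating:
  fixes x :: "nat \<Rightarrow> 'a"
  assumes "odd k" and per: "\<And>i. x (i + k) = x i"
    and hub: "\<And>i. x i \<noteq> v" "\<And>i. letters_alternate v (x i) w"
    and rim: "\<And>i. x i \<noteq> x (i + 1)" "\<And>i. letters_alternate (x i) (x (i + 1)) w"
    and chord: "\<And>i. x i \<noteq> x (i + 2)" "\<And>i. \<not> letters_alternate (x i) (x (i + 2)) w"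
  shows False
proof -
  define up where "up i = dominates w v (x i) (x (i + 1))" for i :: nat
  have edge: "up i \<or> dominates w v (x (i + 1)) (x i)" for i
    using letters_alternate_iff_dominates[OF hub(1) hub(1) rim(1) hub(2) hub(2), of i] rim(2)[of i]
    by (simp add: up_def)
  have no_chord: "\<not> dominates w v (x i) (x (i + 2)) \<and> \<not> dominates w v (x (i + 2)) (x i)" for i
    using letters_alternate_iff_dominates[OF hub(1) hub(1) chord(1) hub(2) hub(2), of i] chord(2)[of i]
    by simp
  have flip: "up (Suc i) \<longleftrightarrow> \<not> up i" for i
  proof
    show "\<not> up i" if "up (Suc i)"
      using that no_chord[of i] dominates_trans[of w v "x i" "x (i + 1)" "x (i + 2)"]
      by (auto simp: up_def)
    show "up (Suc i)" if "\<not> up i"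
      using that edge[of i] edge[of "Suc i"] no_chord[of i]
        dominates_trans[of w v "x (i + 2)" "x (i + 1)" "x i"]
      by auto
  qed
  have "up i \<longleftrightarrow> (up 0 \<longleftrightarrow> even i)" for i
    by (induction i) (auto simp: flip)
  from this[of k] have "up k \<longleftrightarrow> \<not> up 0" using \<open>odd k\<close> by simp
  moreover have "up k \<longleftrightarrow> up 0"
    using per[of 0] per[of 1] by (simp add: up_def add.commute)
  ultimately show False by simp
qed

text \<open>Reading indices modulo the length turns the list into a periodic sequence. With
  rotations for the cyclic neighbours, the hypotheses can be checked by simplification on an
  explicit rim.\<close>

lemma odd_wheel_list_not_alternating:
  assumes "odd (length xs)" "length xs \<ge> 3" "distinct (v # xs)"
    and hub: "list_all (\<lambda>x. letters_alternate v x w) xs"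
    and rim: "list_all2 (\<lambda>x y. letters_alternate x y w) xs (rotate 1 xs)"
    and chord: "list_all2 (\<lambda>x y. \<not> letters_alternate x y w) xs (rotate 2 xs)"
  shows False
proof (rule odd_wheel_not_alternating[of "length xs" "\<lambda>i. xs ! (i mod length xs)" v w])
  have len: "i mod length xs < length xs" for i
    using assms(2) by (intro mod_less_divisor) linarith
  have neq: "xs ! (i mod length xs) \<noteq> xs ! ((i + j) mod length xs)" if "0 < j" "j < length xs" for i j
  proof
    assume "xs ! (i mod length xs) = xs ! ((i + j) mod length xs)"
    then have "(i + j) mod length xs = i mod length xs"
      using assms(3) len by (metis distinct.simps(2) nth_eq_iff_index_eq)
    then have "length xs dvd j"
      using mod_eq_dvd_iff_nat[of i "i + j" "length xs"] by simp
    then show False using that by (auto dest: dvd_imp_le)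
  qed
  fix i
  show "xs ! (i mod length xs) \<noteq> v" using assms(3) len[of i] by (metis distinct.simps(2) nth_mem)
  show "letters_alternate v (xs ! (i mod length xs)) w" using hub len by (simp add: list_all_length)
  show "xs ! (i mod length xs) \<noteq> xs ! ((i + 1) mod length xs)" using neq[of 1] assms(2) by simp
  show "xs ! (i mod length xs) \<noteq> xs ! ((i + 2) mod length xs)" using neq[of 2] assms(2) by simp
  show "letters_alternate (xs ! (i mod length xs)) (xs ! ((i + 1) mod length xs)) w"
    using list_all2_nthD[OF rim len[of i]] len[of i]
    by (simp add: nth_rotate1 mod_simps)
  show "\<not> letters_alternate (xs ! (i mod length xs)) (xs ! ((i + 2) mod length xs)) w"
    using list_all2_nthD[OF chord len[of i]] len[of i]
    by (simp add: nth_rotate mod_simps)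
qed (use assms in simp_all)

section \<open>Representing 3-colourable graphs\<close>

lemma filter_pair_sorted:
  assumes "distinct L" "x \<in> set L" "y \<in> set L" "x \<noteq> y" "sorted_wrt R L" "\<not> R y x"
  shows "filter (\<lambda>z. z = x \<or> z = y) L = [x, y]"
proof -
  let ?l = "filter (\<lambda>z. z = x \<or> z = y) L"
  have "set ?l = {x, y}" "distinct ?l" using assms by auto
  then have "length ?l = 2" using assms(4) by (metis card_2_iff distinct_card)
  then obtain a b where ab: "?l = [a, b]"
    by (auto simp: numeral_2_eq_2 length_Suc_conv)
  then have "{a, b} = {x, y}" using \<open>set ?l = {x, y}\<close> by simp
  moreover have "R a b" using sorted_wrt_filter[OF assms(5), of "\<lambda>z. z = x \<or> z = y"] ab by simp
  ultimately show ?thesis using ab assms(6) by (auto simp: doubleton_eq_iff)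
qed

text \<open>Stronger than alternation: every arc starts with its tail and ends with its head, so the
  property survives concatenation. The number \<open>k\<close> may depend on the arc.\<close>

definition edge_uniform :: "('a \<Rightarrow> 'a \<Rightarrow> bool) \<Rightarrow> 'a list \<Rightarrow> bool" where
  "edge_uniform D w \<longleftrightarrow>
     (\<forall>x y. D x y \<longrightarrow> (\<exists>k. filter (\<lambda>z. z = x \<or> z = y) w = concat (replicate k [x, y])))"

lemma edge_uniform_Nil: "edge_uniform D []"
  by (auto simp: edge_uniform_def intro: exI[of _ 0])

lemma edge_uniform_append: "edge_uniform D u \<Longrightarrow> edge_uniform D w \<Longrightarrow> edge_uniform D (u @ w)"
  unfolding edge_uniform_def by (simp, metis concat_append replicate_add)

lemma distinct_adj_concat_replicate:
  assumes "x \<noteq> y"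
  shows "distinct_adj (concat (replicate k [x, y]))"
proof (induction k)
  case (Suc k)
  then show ?case using assms by (cases k) auto
qed simp

lemma edge_uniform_imp_letters_alternate:
  assumes "edge_uniform D w" "D x y" "x \<noteq> y"
  shows "letters_alternate x y w"
  using assms distinct_adj_concat_replicate[OF assms(3)]
  unfolding edge_uniform_def letters_alternate_iff_distinct_adj[OF assms(3)] by metis

lemma letters_alternate_factor:
  "x \<noteq> y \<Longrightarrow> letters_alternate x y (u @ w) \<Longrightarrow> letters_alternate x y u \<and> letters_alternate x y w"
  by (simp add: letters_alternate_iff_distinct_adj distinct_adj_append_iff)

lemma letters_alternate_commute: "letters_alternate x y w \<longleftrightarrow> letters_alternate y x w"
proof -
  have "(\<lambda>z. z = y \<or> z = x) = (\<lambda>z. z = x \<or> z = y)" by auto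
  then show ?thesis by (auto simp: letters_alternate_def)
qed

text \<open>A pair that fails to alternate in a factor fails in the whole word, so breaking words
  for single pairs can be concatenated.\<close>

lemma edge_uniform_breaking_pairs:
  assumes "finite S"
    and "\<And>x y. (x, y) \<in> S \<Longrightarrow>
      x \<noteq> y \<and> (\<exists>w. set w \<subseteq> V \<and> edge_uniform D w \<and> \<not> letters_alternate x y w)"
  shows "\<exists>w. set w \<subseteq> V \<and> edge_uniform D w \<and> (\<forall>(x, y)\<in>S. \<not> letters_alternate x y w)"
  using assms
proof (induction S rule: finite_induct)
  case empty
  show ?case using edge_uniform_Nil by (intro exI[of _ "[]"]) auto
next
  case (insert s S)
  obtain a b where s: "s = (a, b)" by fastforce
  obtain u where u: "set u \<subseteq> V" "edge_uniform D u" "\<not> letters_alternate a b u" "a \<noteq> b"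
    using insert.prems[of a b] s by auto
  obtain w where w: "set w \<subseteq> V" "edge_uniform D w" "\<forall>(x, y)\<in>S. \<not> letters_alternate x y w"
    using insert by (metis insertCI)
  have "\<not> letters_alternate x y (u @ w)" if "(x, y) \<in> insert s S" for x y
  proof -
    have "x \<noteq> y" using insert.prems[OF that] by blast
    then show ?thesis using that u(3) w(3) s letters_alternate_factor[of x y u w] by auto
  qed
  moreover have "set (u @ w) \<subseteq> V" "edge_uniform D (u @ w)"
    using u w edge_uniform_append[of D u w] by auto
  ultimately show ?case by blast
qed

section \<open>Breaking words from topological orders\<close>

locale coloured_graph =
  fixes V :: "'a set" and E :: "'a set set" and c :: "'a \<Rightarrow> nat"
  assumes finite_V: "finite V"
    and proper: "x \<in> V \<Longrightarrow> y \<in> V \<Longrightarrow> {x, y} \<in> E \<Longrightarrow> c x \<noteq> c y"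
begin

definition arc :: "'a \<Rightarrow> 'a \<Rightarrow> bool" where
  "arc x y \<longleftrightarrow> x \<in> V \<and> y \<in> V \<and> {x, y} \<in> E \<and> c x < c y"

lemma filter_arc_topological:
  assumes "distinct L" "set L = V" "sorted_wrt (\<lambda>x y. \<not> arc y x) L" "arc x y"
  shows "filter (\<lambda>z. z = x \<or> z = y) L = [x, y]"
  using assms by (intro filter_pair_sorted[where R = "\<lambda>x y. \<not> arc y x"]) (auto simp: arc_def)

lemma edge_uniform_topological:
  assumes "distinct L" "set L = V" "sorted_wrt (\<lambda>x y. \<not> arc y x) L"
  shows "edge_uniform arc L"
  using filter_arc_topological[OF assms] unfolding edge_uniform_def
  by (metis append_Nil2 concat.simps replicate_0 replicate_Suc)

text \<open>Sorting by a key that increases along arcs gives a topological order.\<close>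

lemma topological_order_of_key:
  fixes f :: "'a \<Rightarrow> nat"
  assumes "\<And>x y. arc x y \<Longrightarrow> f x < f y" "y \<in> V" "x \<in> V" "f y < f x"
  shows "\<exists>L. set L = V \<and> edge_uniform arc L \<and> filter (\<lambda>z. z = x \<or> z = y) L = [y, x]"
proof -
  obtain l where l: "set l = V" "distinct l" using finite_V finite_distinct_list by blast
  let ?L = "sort_key f l"
  have s: "sorted_wrt (\<lambda>x y. f x \<le> f y) ?L"
    using sorted_sort_key[of f l] by (simp add: sorted_map)
  have "edge_uniform arc ?L"
  proof (rule edge_uniform_topological)
    show "sorted_wrt (\<lambda>x y. \<not> arc y x) ?L"
    proof (rule sorted_wrt_mono_rel[OF _ s])
      show "\<not> arc q p" if "f p \<le> f q" for p q
        using assms(1)[of q p] that by linarith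
    qed
  qed (use l in auto)
  moreover have "filter (\<lambda>z. z = y \<or> z = x) ?L = [y, x]"
    using l assms by (intro filter_pair_sorted[OF _ _ _ _ s]) auto
  moreover have "(\<lambda>z. z = y \<or> z = x) = (\<lambda>z. z = x \<or> z = y)" by auto
  ultimately show ?thesis using l by (intro exI[of _ ?L]) simp
qed

text \<open>Joining the two sorted orders leaves \<open>xyyx\<close>, with a repeated
  \<open>y\<close>.\<close>

lemma breaking_word_of_keys:
  fixes f g :: "'a \<Rightarrow> nat"
  assumes "\<And>x y. arc x y \<Longrightarrow> f x < f y" "\<And>x y. arc x y \<Longrightarrow> g x < g y"
    and "x \<in> V" "y \<in> V" "f x < f y" "g y < g x"
  shows "\<exists>w. set w \<subseteq> V \<and> edge_uniform arc w \<and> \<not> letters_alternate x y w"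
proof -
  obtain L where L: "set L = V" "edge_uniform arc L" "filter (\<lambda>z. z = y \<or> z = x) L = [x, y]"
    using topological_order_of_key[of f x y] assms by blast
  obtain M where M: "set M = V" "edge_uniform arc M" "filter (\<lambda>z. z = x \<or> z = y) M = [y, x]"
    using topological_order_of_key[of g y x] assms by blast
  have "(\<lambda>z. z = y \<or> z = x) = (\<lambda>z. z = x \<or> z = y)" by auto
  then have "\<not> letters_alternate x y (L @ M)"
    using L M assms by (subst letters_alternate_iff_distinct_adj) auto
  then show ?thesis using L M edge_uniform_append[of arc L M] by (intro exI[of _ "L @ M"]) auto
qed

lemma breaking_word_close_colours:
  assumes "x \<in> V" "y \<in> V" "x \<noteq> y" "{x, y} \<notin> E" "c x \<le> c y" "c y \<le> c x + 1"
  shows "\<exists>w. set w \<subseteq> V \<and> edge_uniform arc w \<and> \<not> letters_alternate x y w"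
proof (rule breaking_word_of_keys)
  \<comment> \<open>The factor 3 leaves two free keys above each colour. \<open>?f\<close> puts
    \<open>y\<close> after \<open>x\<close>; \<open>?g\<close> moves both just above the colour of
    \<open>x\<close>, with \<open>y\<close> first. As \<open>x\<close> and \<open>y\<close> are not
    adjacent and their colours differ by at most 1, no arc is reversed.\<close>
  let ?f = "(\<lambda>z. 3 * c z)(y := 3 * c y + 1)"
  let ?g = "(\<lambda>z. 3 * c z)(y := 3 * c x + 1, x := 3 * c x + 2)"
  show "?f a < ?f b" if "arc a b" for a b
    using that by (auto simp: arc_def)
  have "{y, x} \<notin> E" using assms(4) by (simp add: insert_commute)
  then show "?g a < ?g b" if "arc a b" for a b
    using that assms by (auto simp: arc_def)
  show "?f x < ?f y" "?g y < ?g x" using assms by auto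
qed (use assms in auto)

text \<open>A path through an intermediate colour may force \<open>x\<close> before \<open>y\<close>
  in every topological order. But \<open>y\<close> may end one order and \<open>x\<close> begin the
  next; exchanging these two letters where the orders meet gives \<open>xxyy\<close> on the
  pair.\<close>

lemma breaking_word_extreme_colours:
  assumes "x \<in> V" "y \<in> V" "{x, y} \<notin> E" "c x < c y"
    and "\<And>z. z \<in> V \<Longrightarrow> c x \<le> c z \<and> c z \<le> c y"
  shows "\<exists>w. set w \<subseteq> V \<and> edge_uniform arc w \<and> \<not> letters_alternate x y w"
proof -
  obtain l where l: "set l = V" "distinct l" using finite_V finite_distinct_list by blast
  define A where "A = sort_key c (removeAll y l)"
  define B where "B = sort_key c (removeAll x l)"
  have s: "sorted_wrt (\<lambda>x y. c x \<le> c y) (sort_key c k)" for k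
    using sorted_sort_key[of c k] by (simp add: sorted_map)
  have sA: "sorted_wrt (\<lambda>x y. \<not> arc y x) A" and sB: "sorted_wrt (\<lambda>x y. \<not> arc y x) B"
    unfolding A_def B_def by (auto intro: sorted_wrt_mono_rel[OF _ s] simp: arc_def)
  have set: "set A = V - {y}" "set B = V - {x}" using l by (auto simp: A_def B_def)
  have dist: "distinct A" "distinct B" using l by (auto simp: A_def B_def distinct_removeAll)
  have extreme: "\<not> arc y z" "\<not> arc z x" for z
    using assms(5)[of z] by (auto simp: arc_def)
  have tA: "filter (\<lambda>z. z = p \<or> z = q) (A @ [y]) = [p, q]" if "arc p q" for p q
    using set dist sA that assms extreme
    by (intro filter_arc_topological) (auto simp: sorted_wrt_append)
  have tB: "filter (\<lambda>z. z = p \<or> z = q) (x # B) = [p, q]" if "arc p q" for p q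
    using set dist sB that assms extreme
    by (intro filter_arc_topological) (auto simp: sorted_wrt_append)
  let ?w = "A @ [x, y] @ B"
  have "edge_uniform arc ?w" unfolding edge_uniform_def
  proof (intro allI impI)
    fix p q assume a: "arc p q"
    then have "\<not> ((x = p \<or> x = q) \<and> (y = p \<or> y = q))"
      using assms(3,4) by (auto simp: arc_def insert_commute)
    \<comment> \<open>An arc keeps at most one of the two middle letters, so it does not see the
      exchange.\<close>
    then have "filter (\<lambda>z. z = p \<or> z = q) ?w
        = filter (\<lambda>z. z = p \<or> z = q) (A @ [y]) @ filter (\<lambda>z. z = p \<or> z = q) (x # B)"
      by auto
    also have "\<dots> = concat (replicate 2 [p, q])"
      using tA[OF a] tB[OF a] by (simp add: numeral_2_eq_2)
    finally show "\<exists>k. filter (\<lambda>z. z = p \<or> z = q) ?w = concat (replicate k [p, q])" by blast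
  qed
  moreover have "\<not> letters_alternate x y ?w"
  proof -
    have "x \<noteq> y" using assms(4) by auto
    \<comment> \<open>The relation says that \<open>y\<close> precedes nothing. Hence
      \<open>A\<close> contributes a single \<open>x\<close>, followed at once by the
      \<open>x\<close> of the middle pair.\<close>
    then have "filter (\<lambda>z. z = x \<or> z = y) (A @ [y]) = [x, y]"
      using set dist assms
      by (intro filter_pair_sorted[where R = "\<lambda>p q. p \<noteq> y"])
        (auto simp: sorted_wrt_append intro: sorted_wrt_mono_rel[OF _ sA])
    then have "filter (\<lambda>z. z = x \<or> z = y) A = [x]" by simp
    then show ?thesis using \<open>x \<noteq> y\<close> by (simp add: letters_alternate_iff_distinct_adj)
  qed
  ultimately show ?thesis using set assms by (intro exI[of _ ?w]) auto
qed

end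

lemma three_colorable_imp_word_representable:
  assumes "finite V" "colorable 3 V E"
  shows "word_representable V E"
proof -
  obtain c :: "'a \<Rightarrow> nat" where c: "c ` V \<subseteq> {..<3}"
    "\<forall>x\<in>V. \<forall>y\<in>V. {x, y} \<in> E \<longrightarrow> c x \<noteq> c y"
    using assms(2) by (auto simp: colorable_def)
  interpret coloured_graph V E c using assms(1) c by unfold_locales auto
  have break: "\<exists>w. set w \<subseteq> V \<and> edge_uniform arc w \<and> \<not> letters_alternate x y w"
    if "x \<in> V" "y \<in> V" "x \<noteq> y" "{x, y} \<notin> E" "c x \<le> c y" for x y
  proof (cases "c y \<le> c x + 1")
    case True
    then show ?thesis using that by (intro breaking_word_close_colours)
  next
    case False
    have "c z < 3" if "z \<in> V" for z using c(1) that by auto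
    then have "c z \<le> 2" if "z \<in> V" for z using that by fastforce
    \<comment> \<open>Among three colours, a gap of two leaves only the extreme ones.\<close>
    moreover have "c x = 0" "c y = 2" using False calculation[OF that(2)] by linarith+
    ultimately show ?thesis using that by (intro breaking_word_extreme_colours) auto
  qed
  define S where "S = {(x, y) \<in> V \<times> V. x \<noteq> y \<and> {x, y} \<notin> E \<and> c x \<le> c y}"
  have "finite S" using assms(1) by (auto simp: S_def intro: finite_subset[of _ "V \<times> V"])
  moreover have "x \<noteq> y \<and> (\<exists>w. set w \<subseteq> V \<and> edge_uniform arc w \<and> \<not> letters_alternate x y w)"
    if "(x, y) \<in> S" for x y
    using that break[of x y] unfolding S_def by blast
  ultimately obtain w where w: "set w \<subseteq> V" "edge_uniform arc w"
    "\<forall>(x, y)\<in>S. \<not> letters_alternate x y w"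
    using edge_uniform_breaking_pairs[of S V arc] by blast
  have "letters_alternate x y w \<longleftrightarrow> {x, y} \<in> E"
    if "x \<in> V" "y \<in> V" "x \<noteq> y" "c x \<le> c y" for x y
  proof
    assume "{x, y} \<in> E"
    then have "arc x y" using that proper[of x y] by (simp add: arc_def)
    then show "letters_alternate x y w" using edge_uniform_imp_letters_alternate[OF w(2)] that(3) by blast
  qed (use w that in \<open>auto simp: S_def\<close>)
  then have "letters_alternate x y w \<longleftrightarrow> {x, y} \<in> E" if "x \<in> V" "y \<in> V" "x \<noteq> y" for x y
    using that letters_alternate_commute[of x y w] by (metis insert_commute nle_le)
  then show ?thesis using w(1) by (auto simp: word_representable_def)
qed

section \<open>Grid triangulations\<close>

text \<open>A Boolean pattern marks the main squares, so that degree parities become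
  equivalences.\<close>

definition triangulation_edges :: "nat \<Rightarrow> nat \<Rightarrow> (nat \<Rightarrow> nat \<Rightarrow> bool) \<Rightarrow> (nat \<times> nat) set set" where
  "triangulation_edges m n M = grid_edges m n \<union>
     {if M i j then {(i, j), (i + 1, j + 1)} else {(i + 1, j), (i, j + 1)} | i j. i < m \<and> j < n}"

lemma grid_triangulation_imp_triangulation_edges:
  assumes "grid_triangulation m n E"
  shows "\<exists>M. E = triangulation_edges m n M"
proof -
  obtain d where d: "\<forall>i<m. \<forall>j<n. d i j \<in> square_diagonals i j"
    "E = grid_edges m n \<union> {d i j | i j. i < m \<and> j < n}"
    using assms by (auto simp: grid_triangulation_def)
  let ?M = "\<lambda>i j. d i j = {(i, j), (i + 1, j + 1)}"
  have "d i j = (if ?M i j then {(i, j), (i + 1, j + 1)} else {(i + 1, j), (i, j + 1)})"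
    if "i < m" "j < n" for i j
    using d(1) that unfolding square_diagonals_def by (metis insertE singletonD)
  then have "{d i j | i j. i < m \<and> j < n} =
    {if ?M i j then {(i, j), (i + 1, j + 1)} else {(i + 1, j), (i, j + 1)} | i j. i < m \<and> j < n}"
    by (metis (no_types, lifting))
  then have "E = triangulation_edges m n ?M" unfolding d(2) triangulation_edges_def by simp
  then show ?thesis by blast
qed

text \<open>One disjunct for each of the eight directions to a neighbour; adjacency of explicit
  points is then decided by simplification.\<close>

lemma triangulation_edge_iff:
  "{(a, b), (a', b')} \<in> triangulation_edges m n M \<longleftrightarrow>
     a' = Suc a \<and> b' = b \<and> a < m \<and> b \<le> n \<or> a = Suc a' \<and> b' = b \<and> a' < m \<and> b \<le> n \<or>
     a' = a \<and> b' = Suc b \<and> a \<le> m \<and> b < n \<or> a' = a \<and> b = Suc b' \<and> a \<le> m \<and> b' < n \<or>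
     a' = Suc a \<and> b' = Suc b \<and> a < m \<and> b < n \<and> M a b \<or>
     a = Suc a' \<and> b = Suc b' \<and> a' < m \<and> b' < n \<and> M a' b' \<or>
     a = Suc a' \<and> b' = Suc b \<and> a' < m \<and> b < n \<and> \<not> M a' b \<or>
     a' = Suc a \<and> b = Suc b' \<and> a < m \<and> b' < n \<and> \<not> M a b'"
proof -
  have diag: "{(a, b), (a', b')} \<in>
      {if M i j then {(i, j), (i + 1, j + 1)} else {(i + 1, j), (i, j + 1)} | i j. i < m \<and> j < n} \<longleftrightarrow>
    (\<exists>i j. i < m \<and> j < n \<and> (M i j \<and> {(a, b), (a', b')} = {(i, j), (i + 1, j + 1)} \<or>
       \<not> M i j \<and> {(a, b), (a', b')} = {(i + 1, j), (i, j + 1)}))"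
    by (auto; metis)
  show ?thesis
    unfolding triangulation_edges_def grid_edges_def Un_iff diag
    by (auto simp: doubleton_eq_iff)
qed

text \<open>An interior vertex has four grid neighbours and one more per diagonal ending there: from
  main squares at lower left and upper right, from the others at the remaining corners. So its
  degree has the parity of the number of main squares around it.\<close>

lemma even_degree_if_word_representable:
  assumes rep: "word_representable (grid_vertices m n) (triangulation_edges m n M)"
    and "Suc i < m" "Suc j < n"
  shows "(M i j \<longleftrightarrow> M (Suc i) j) \<longleftrightarrow> (M i (Suc j) \<longleftrightarrow> M (Suc i) (Suc j))"
proof (rule ccontr)
  assume parity: "\<not> ?thesis"
  obtain w where w: "\<forall>x\<in>grid_vertices m n. \<forall>y\<in>grid_vertices m n. x \<noteq> y \<longrightarrow>
      (letters_alternate x y w \<longleftrightarrow> {x, y} \<in> triangulation_edges m n M)"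
    using rep by (auto simp: word_representable_def)
  let ?v = "(Suc i, Suc j)"
  let ?e = "(Suc (Suc i), Suc j)" and ?ne = "(Suc (Suc i), Suc (Suc j))"
    and ?n = "(Suc i, Suc (Suc j))" and ?nw = "(i, Suc (Suc j))"
    and ?w = "(i, Suc j)" and ?sw = "(i, j)" and ?s = "(Suc i, j)" and ?se = "(Suc (Suc i), j)"
  \<comment> \<open>The neighbours of \<open>?v\<close> counterclockwise from the east. Where a
    corner is missing, the diagonal of its square joins the two adjacent sides and closes the
    rim.\<close>
  define xs where "xs =
    [?e] @ (if M (Suc i) (Suc j) then [?ne] else []) @ [?n] @ (if M i (Suc j) then [] else [?nw]) @
    [?w] @ (if M i j then [?sw] else []) @ [?s] @ (if M (Suc i) j then [] else [?se])"
  have alt: "letters_alternate (a, b) (a', b') w \<longleftrightarrow> {(a, b), (a', b')} \<in> triangulation_edges m n M"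
    if "a \<le> m" "b \<le> n" "a' \<le> m" "b' \<le> n" "a \<noteq> a' \<or> b \<noteq> b'" for a b a' b'
    using w that by (auto simp: grid_vertices_def)
  have "odd (length xs)" "length xs \<ge> 3"
    using parity unfolding xs_def
    by (cases "M i j"; cases "M (Suc i) j"; cases "M i (Suc j)"; cases "M (Suc i) (Suc j)"; simp)+
  moreover have "distinct (?v # xs)" by (simp add: xs_def)
  moreover have "list_all (\<lambda>x. letters_alternate ?v x w) xs"
    using assms(2,3) by (simp add: xs_def alt triangulation_edge_iff)
  moreover have "list_all2 (\<lambda>x y. letters_alternate x y w) xs (rotate 1 xs)"
    using parity assms(2,3) unfolding xs_def
    by (cases "M i j"; cases "M (Suc i) j"; cases "M i (Suc j)"; cases "M (Suc i) (Suc j)";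
        simp add: alt triangulation_edge_iff)
  \<comment> \<open>Rim vertices two apart differ by two in a coordinate, or surround a listed
    corner, whose square has its diagonal at \<open>?v\<close>.\<close>
  moreover have "list_all2 (\<lambda>x y. \<not> letters_alternate x y w) xs (rotate 2 xs)"
    using parity assms(2,3) unfolding xs_def
    by (cases "M i j"; cases "M (Suc i) j"; cases "M i (Suc j)"; cases "M (Suc i) (Suc j)";
        simp add: alt triangulation_edge_iff numeral_2_eq_2)
  ultimately show False by (rule odd_wheel_list_not_alternating)
qed

section \<open>The colouring modulo 3\<close>

text \<open>The natural number 2 stands for -1 modulo 3.\<close>

definition step :: "bool \<Rightarrow> nat" where
  "step p = (if p then 1 else 2)"

fun walk :: "(nat \<Rightarrow> bool) \<Rightarrow> nat \<Rightarrow> nat" where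
  "walk \<alpha> 0 = 0"
| "walk \<alpha> (Suc i) = walk \<alpha> i + step (\<alpha> i)"

text \<open>These are the four kinds of edges: horizontal, vertical, main diagonal (equal steps add
  up to 2 or -2), other diagonal (opposite steps differ).\<close>

lemma step_mod_3:
  shows "(x + step p + y) mod 3 \<noteq> (x + y) mod 3"
    and "(x + (y + step p)) mod 3 \<noteq> (x + y) mod 3"
    and "(x + step p + (y + step p)) mod 3 \<noteq> (x + y) mod 3"
    and "p \<noteq> q \<Longrightarrow> (x + step p + y) mod 3 \<noteq> (x + (y + step q)) mod 3"
  unfolding step_def by (cases p; cases q; simp; presburger)+

lemma colorable_if_product_pattern:
  assumes "\<And>i j. i < m \<Longrightarrow> j < n \<Longrightarrow> M i j \<longleftrightarrow> (\<alpha> i \<longleftrightarrow> \<beta> j)"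
  shows "colorable 3 (grid_vertices m n) (triangulation_edges m n M)"
proof -
  let ?c = "\<lambda>(i, j). (walk \<alpha> i + walk \<beta> j) mod 3"
  have "?c (a, b) \<noteq> ?c (a', b')" if "{(a, b), (a', b')} \<in> triangulation_edges m n M" for a b a' b'
    using that unfolding triangulation_edge_iff
    by (elim disjE conjE) (use assms in \<open>simp_all add: step_mod_3 step_mod_3[symmetric]\<close>)
  then show ?thesis unfolding colorable_def
    by (intro exI[of _ ?c]) (auto simp del: walk.simps)
qed

text \<open>Over the field with two elements the mixed second difference of \<open>M\<close>
  vanishes, so \<open>M\<close> is a function of \<open>i\<close> plus a function of
  \<open>j\<close>; \<open>M 0 0\<close> corrects the corner counted twice.\<close>

lemma product_pattern_if_even_degrees:
  assumes even: "\<And>i j. Suc i < m \<Longrightarrow> Suc j < n \<Longrightarrow>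
      (M i j \<longleftrightarrow> M (Suc i) j) \<longleftrightarrow> (M i (Suc j) \<longleftrightarrow> M (Suc i) (Suc j))"
    and "i < m" "j < n"
  shows "M i j \<longleftrightarrow> (M i 0 \<longleftrightarrow> (M 0 j \<longleftrightarrow> M 0 0))"
proof -
  \<comment> \<open>Whether \<open>M\<close> changes from \<open>i\<close> to \<open>Suc i\<close>
    is the same for all \<open>j\<close>.\<close>
  have row: "(M i j \<longleftrightarrow> M (Suc i) j) \<longleftrightarrow> (M i 0 \<longleftrightarrow> M (Suc i) 0)" if "Suc i < m" "j < n" for i j
    using that(2) by (induction j) (use even that(1) in auto)
  show ?thesis
    using \<open>i < m\<close>
  proof (induction i)
    case (Suc i)
    then show ?case using row[OF Suc.prems \<open>j < n\<close>] by auto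
  qed auto
qed

theorem theorem6:
  fixes m n :: nat and E :: "(nat \<times> nat) set set"
  assumes "m \<ge> 1" and "n \<ge> 1"
    and "grid_triangulation m n E"
  shows "word_representable (grid_vertices m n) E \<longleftrightarrow> colorable 3 (grid_vertices m n) E"
proof
  obtain M where M: "E = triangulation_edges m n M"
    using grid_triangulation_imp_triangulation_edges[OF assms(3)] by blast
  assume "word_representable (grid_vertices m n) E"
  then show "colorable 3 (grid_vertices m n) E"
    unfolding M
    by (intro colorable_if_product_pattern[where \<alpha> = "\<lambda>i. M i 0" and \<beta> = "\<lambda>j. M 0 j \<longleftrightarrow> M 0 0"]
        product_pattern_if_even_degrees even_degree_if_word_representable)
next
  assume "colorable 3 (grid_vertices m n) E"
  then show "word_representable (grid_vertices m n) E"
    by (intro three_colorable_imp_word_representable) (simp_all add: grid_vertices_def)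
qed

end
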